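(* For every $N\ge0$, \[ \bar Z_N=\sum_{\sigma\in\mathfrak S_{N+1}}\alpha^{s(\sigma)-1}\beta^{t(\sigma)-1}y^{\mathrm{asc}(\sigma)-1}q^{\text{31-2}(\sigma)}. \]
   Context: Let $\mathcal A$ be the associative algebra over $\mathbb Z[y,q]$ generated by $D,E$ subject to $DE-qED=D+E$; every element is uniquely a finite $\mathbb Z[y,q]$-combination of words $E^iD^j$, and we write $(yD+E)^N=\sum_{i,j}c^{(N)}_{i,j}E^iD^j$. Define $\bar Z_N(\alpha,\beta,y,q)=\sum_{i,j}c^{(N)}_{i,j}\alpha^{i}\beta^{j}$ (the PASEP partition function with $\alpha,\beta$ replaced by $1/\alpha,1/\beta$). For $\sigma\in\mathfrak S_n$: $s(\sigma)$ is the number of right-to-left maxima (positions $j$ with $\sigma(j)=\max_{l\ge j}\sigma(l)$); $t(\sigma)$ is the number of right-to-left minima (positions $j$ with $\sigma(j)=\min_{l\ge j}\sigma(l)$); $\mathrm{asc}(\sigma)$ is the number of $i$ with $i=n$ or ($1\le i\le n-1$ and $\sigma(i)<\sigma(i+1)$); $\text{31-2}(\sigma)$ is the number of triples $(i,i+1,j)$ with $1\le i<i+1<j\le n$ and $\sigma(i+1)<\sigma(j)<\sigma(i)$. *)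

theory Defs
  imports
    "HOL-Computational_Algebra.Polynomial"
    "HOL-Library.Poly_Mapping"
    "HOL-Combinatorics.Permutations"
begin

section \<open>The coefficient rings\<close>

text \<open>The outer variable of the nested polynomial type is \<open>y\<close>, the inner one is \<open>q\<close>.\<close>

type_synonym zyq = "int poly poly"

definition y_ind :: zyq where "y_ind = [:0, 1:]"

definition q_ind :: zyq where "q_ind = [:[:0, 1:]:]"

text \<open>The ring of polynomials in \<open>\<alpha>, \<beta>, y, q\<close> over the integers: the outermost variable
  is \<open>\<beta>\<close>, the next one is \<open>\<alpha>\<close>.\<close>

type_synonym zabyq = "zyq poly poly"

definition alpha_ind :: zabyq where "alpha_ind = [:[:0, 1:]:]"

definition beta_ind :: zabyq where "beta_ind = [:0, 1:]"

definition zyq_embed :: "zyq \<Rightarrow> zabyq" where "zyq_embed c = [:[:c:]:]"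


section \<open>The free algebra on two generators\<close>

datatype letter = Letter_D | Letter_E

datatype word = Word (letters: "letter list")

text \<open>Words form a free monoid under concatenation. It is written additively because
  \<open>Poly_Mapping\<close> defines the convolution product for additive (not necessarily
  commutative) monoids; thus \<open>word \<Rightarrow>\<^sub>0 zyq\<close> is the free associative algebra.\<close>

instantiation word :: monoid_add
begin

definition "0 = Word []"

definition "u + v = Word (letters u @ letters v)"

instance
  by standard (simp_all add: zero_word_def plus_word_def)

end

type_synonym free_alg = "word \<Rightarrow>\<^sub>0 zyq"

definition free_D :: free_alg where
  "free_D = Poly_Mapping.single (Word [Letter_D]) 1"

definition free_E :: free_alg where
  "free_E = Poly_Mapping.single (Word [Letter_E]) 1"

definition free_scalar :: "zyq \<Rightarrow> free_alg" where
  "free_scalar c = Poly_Mapping.single 0 c"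


section \<open>The algebra with relation DE - qED = D + E\<close>

inductive_set two_sided_ideal :: "'a::ring_1 set \<Rightarrow> 'a set" for S where
  gen: "x \<in> S \<Longrightarrow> x \<in> two_sided_ideal S"
| zero: "0 \<in> two_sided_ideal S"
| add: "x \<in> two_sided_ideal S \<Longrightarrow> y \<in> two_sided_ideal S \<Longrightarrow> x + y \<in> two_sided_ideal S"
| mult_left: "x \<in> two_sided_ideal S \<Longrightarrow> r * x \<in> two_sided_ideal S"
| mult_right: "x \<in> two_sided_ideal S \<Longrightarrow> x * r \<in> two_sided_ideal S"

lemma two_sided_ideal_uminus:
  "x \<in> two_sided_ideal S \<Longrightarrow> - x \<in> two_sided_ideal S"
  using two_sided_ideal.mult_left[of x S "- 1"] by simp

definition pasep_ideal :: "free_alg set" where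
  "pasep_ideal = two_sided_ideal
     {free_D * free_E - free_scalar q_ind * free_E * free_D - (free_D + free_E)}"

definition pasep_rel :: "free_alg \<Rightarrow> free_alg \<Rightarrow> bool" where
  "pasep_rel a b \<longleftrightarrow> a - b \<in> pasep_ideal"

lemma equivp_pasep_rel: "equivp pasep_rel"
proof (rule equivpI)
  show "reflp pasep_rel"
    by (rule reflpI) (simp add: pasep_rel_def pasep_ideal_def two_sided_ideal.zero)
  show "symp pasep_rel"
  proof (rule sympI)
    fix a b assume "pasep_rel a b"
    then show "pasep_rel b a"
      using two_sided_ideal_uminus[of "a - b"] by (simp add: pasep_rel_def pasep_ideal_def)
  qed
  show "transp pasep_rel"
  proof (rule transpI)
    fix a b c assume "pasep_rel a b" "pasep_rel b c"
    then show "pasep_rel a c"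
      using two_sided_ideal.add[of "a - b" _ "b - c"] by (simp add: pasep_rel_def pasep_ideal_def)
  qed
qed

quotient_type pasep_alg = free_alg / pasep_rel
  by (rule equivp_pasep_rel)

lemma pasep_rel_add: "pasep_rel a a' \<Longrightarrow> pasep_rel b b' \<Longrightarrow> pasep_rel (a + b) (a' + b')"
  using two_sided_ideal.add[of "a - a'" _ "b - b'"]
  by (simp add: pasep_rel_def pasep_ideal_def algebra_simps)

lemma pasep_rel_uminus: "pasep_rel a a' \<Longrightarrow> pasep_rel (- a) (- a')"
  using two_sided_ideal_uminus[of "a - a'"]
  by (simp add: pasep_rel_def pasep_ideal_def algebra_simps)

lemma pasep_rel_mult:
  assumes "pasep_rel a a'" "pasep_rel b b'"
  shows "pasep_rel (a * b) (a' * b')"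
proof -
  have "(a - a') * b + a' * (b - b') \<in> pasep_ideal"
    using assms unfolding pasep_rel_def pasep_ideal_def
    by (intro two_sided_ideal.add two_sided_ideal.mult_left two_sided_ideal.mult_right)
  then show ?thesis
    by (simp add: pasep_rel_def algebra_simps)
qed

lemma word_add_eq_0_iff: "u + v = 0 \<longleftrightarrow> u = 0 \<and> v = (0 :: word)"
  by (cases u; cases v) (auto simp: zero_word_def plus_word_def)

lemma lookup_free_mult_0:
  fixes f g :: free_alg
  shows "Poly_Mapping.lookup (f * g) 0 = Poly_Mapping.lookup f 0 * Poly_Mapping.lookup g 0"
proof -
  have inner: "(\<Sum>v. Poly_Mapping.lookup g v when u + v = 0)
      = (Poly_Mapping.lookup g 0 when u = 0)" for u
    by (cases "u = 0") (auto simp: word_add_eq_0_iff when_def)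
  have "Poly_Mapping.lookup (f * g) 0
      = (\<Sum>u. Poly_Mapping.lookup f u * (\<Sum>v. Poly_Mapping.lookup g v when u + v = 0))"
    by (simp add: lookup_mult eq_commute[of 0])
  then show ?thesis
    by (simp only: inner mult_when Sum_any_when_equal)
qed

lemma pasep_ideal_lookup_0:
  assumes "x \<in> pasep_ideal"
  shows "Poly_Mapping.lookup x 0 = 0"
proof -
  have D: "Poly_Mapping.lookup free_D 0 = 0" and E: "Poly_Mapping.lookup free_E 0 = 0"
    by (simp_all add: free_D_def free_E_def lookup_single zero_word_def)
  show ?thesis
    using assms unfolding pasep_ideal_def
  proof induction
    case (gen x)
    then show ?case
      by (simp add: lookup_minus lookup_add lookup_free_mult_0 D E)
  qed (simp_all add: lookup_add lookup_free_mult_0)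
qed

instantiation pasep_alg :: ring_1
begin

lift_definition zero_pasep_alg :: pasep_alg is 0 .

lift_definition one_pasep_alg :: pasep_alg is 1 .

lift_definition plus_pasep_alg :: "pasep_alg \<Rightarrow> pasep_alg \<Rightarrow> pasep_alg" is "(+)"
  by (rule pasep_rel_add)

lift_definition uminus_pasep_alg :: "pasep_alg \<Rightarrow> pasep_alg" is uminus
  by (rule pasep_rel_uminus)

lift_definition minus_pasep_alg :: "pasep_alg \<Rightarrow> pasep_alg \<Rightarrow> pasep_alg" is "(-)"
  using pasep_rel_add pasep_rel_uminus by (metis diff_conv_add_uminus)

lift_definition times_pasep_alg :: "pasep_alg \<Rightarrow> pasep_alg \<Rightarrow> pasep_alg" is "(*)"
  by (rule pasep_rel_mult)

instance
proof
  show "(0 :: pasep_alg) \<noteq> 1"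
  proof
    assume "(0 :: pasep_alg) = 1"
    then have "pasep_rel 0 1"
      by (simp add: zero_pasep_alg_def one_pasep_alg_def pasep_alg.abs_eq_iff)
    then have "(- 1 :: free_alg) \<in> pasep_ideal"
      by (simp add: pasep_rel_def)
    from pasep_ideal_lookup_0[OF this] show False
      by (simp add: lookup_one)
  qed
qed (transfer, simp add: equivp_reflp[OF equivp_pasep_rel] algebra_simps)+

end

lift_definition gen_D :: pasep_alg is free_D .

lift_definition gen_E :: pasep_alg is free_E .

lift_definition scalar :: "zyq \<Rightarrow> pasep_alg" is free_scalar .


section \<open>Normal form and partition function\<close>

text \<open>The value at \<open>(i, j)\<close> is the coefficient of \<open>E\<^sup>iD\<^sup>j\<close>. That such an expansion
  exists and is unique for every element is a theorem about the algebra, so the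
  description below always denotes.\<close>

definition normal_form :: "pasep_alg \<Rightarrow> (nat \<times> nat) \<Rightarrow>\<^sub>0 zyq" where
  "normal_form x = (THE c.
     x = (\<Sum>(i, j)\<in>Poly_Mapping.keys c.
            scalar (Poly_Mapping.lookup c (i, j)) * gen_E ^ i * gen_D ^ j))"

definition pasep_coeffs :: "nat \<Rightarrow> (nat \<times> nat) \<Rightarrow>\<^sub>0 zyq" where
  "pasep_coeffs N = normal_form ((scalar y_ind * gen_D + gen_E) ^ N)"

definition Zbar :: "nat \<Rightarrow> zabyq" where
  "Zbar N = (\<Sum>(i, j)\<in>Poly_Mapping.keys (pasep_coeffs N).
     zyq_embed (Poly_Mapping.lookup (pasep_coeffs N) (i, j)) * alpha_ind ^ i * beta_ind ^ j)"


section \<open>Permutation statistics\<close>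

text \<open>A permutation of \<open>{1..n}\<close> is a function \<open>\<sigma>\<close> with \<open>\<sigma> permutes {1..n}\<close>.\<close>

definition rl_maxima :: "nat \<Rightarrow> (nat \<Rightarrow> nat) \<Rightarrow> nat" where
  "rl_maxima n \<sigma> = card {j \<in> {1..n}. \<sigma> j = Max (\<sigma> ` {j..n})}"

definition rl_minima :: "nat \<Rightarrow> (nat \<Rightarrow> nat) \<Rightarrow> nat" where
  "rl_minima n \<sigma> = card {j \<in> {1..n}. \<sigma> j = Min (\<sigma> ` {j..n})}"

text \<open>The last position always counts as an ascent.\<close>

definition asc :: "nat \<Rightarrow> (nat \<Rightarrow> nat) \<Rightarrow> nat" where
  "asc n \<sigma> = card {i \<in> {1..n}. i = n \<or> \<sigma> i < \<sigma> (i + 1)}"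

definition pattern_31_2 :: "nat \<Rightarrow> (nat \<Rightarrow> nat) \<Rightarrow> nat" where
  "pattern_31_2 n \<sigma> = card {(i, i + 1, j) | i j.
     1 \<le> i \<and> i + 1 < j \<and> j \<le> n \<and> \<sigma> (i + 1) < \<sigma> j \<and> \<sigma> j < \<sigma> i}"

end

theory Submission
  imports Defs
begin

text \<open>
  Prepending a first letter \<open>r\<close> to a permutation of \<open>{1..n}\<close> with first letter \<open>a\<close> changes the
  weight by \<open>\<alpha>\<close> if \<open>r = n + 1\<close>, by \<open>\<beta>\<close> if \<open>r = 1\<close>, and by \<open>y\<close> if \<open>r \<le> a\<close> but by
  \<open>q\<^bsup>r-a-1\<^esup>\<close> if \<open>r > a\<close>. So the total weights of the permutations with a given first letter satisfy a
  linear recursion. With \<open>T = yD + E\<close> and \<open>Q = qyD + E\<close>, the same recursion is solved in the algebra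
  by \<open>yT\<^bsup>n-2\<^esup>D\<close> (for \<open>r = 1\<close>), \<open>yT\<^bsup>n-1-r\<^esup>(D + E)Q\<^bsup>r-2\<^esup>\<close> (for \<open>1 < r < n\<close>) and \<open>EQ\<^bsup>n-2\<^esup>\<close> (for
  \<open>r = n\<close>), because \<open>EQ + y(D + E) = TE\<close> and \<open>qTD + D + E = DQ\<close>. These elements add up to
  \<open>T\<^bsup>n-1\<^esup>\<close>.
\<close>


section \<open>Linear extension of functions on monomials\<close>

definition lin_ext :: "('a \<Rightarrow> 'b::zero \<Rightarrow> 'c::comm_monoid_add) \<Rightarrow> ('a \<Rightarrow>\<^sub>0 'b) \<Rightarrow> 'c" where
  "lin_ext g f = (\<Sum>k\<in>Poly_Mapping.keys f. g k (Poly_Mapping.lookup f k))"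

lemma lin_ext_0 [simp]: "lin_ext g 0 = 0"
  by (simp add: lin_ext_def)

lemma lin_ext_superset:
  assumes "finite A" "Poly_Mapping.keys f \<subseteq> A" "\<And>k. g k 0 = 0"
  shows "lin_ext g f = (\<Sum>k\<in>A. g k (Poly_Mapping.lookup f k))"
  unfolding lin_ext_def
  by (rule sum.mono_neutral_left) (use assms in \<open>auto simp: in_keys_iff\<close>)

lemma lin_ext_single:
  assumes "\<And>k. g k 0 = 0"
  shows "lin_ext g (Poly_Mapping.single k a) = g k a"
  using lin_ext_superset[of "{k}" "Poly_Mapping.single k a" g] assms by simp

lemma lin_ext_add:
  fixes f1 f2 :: "'a \<Rightarrow>\<^sub>0 'b::monoid_add"
  assumes "\<And>k. g k 0 = 0" "\<And>k a b. g k (a + b) = g k a + g k b"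
  shows "lin_ext g (f1 + f2) = lin_ext g f1 + lin_ext g f2"
proof -
  let ?A = "Poly_Mapping.keys f1 \<union> Poly_Mapping.keys f2"
  have "lin_ext g f = (\<Sum>k\<in>?A. g k (Poly_Mapping.lookup f k))"
    if "Poly_Mapping.keys f \<subseteq> ?A" for f
    using that assms(1) by (intro lin_ext_superset) auto
  then show ?thesis
    using keys_add[of f1 f2] by (simp add: lookup_add assms(2) sum.distrib)
qed

lemma poly_mapping_add_induct [case_names zero single add]:
  fixes f :: "'a \<Rightarrow>\<^sub>0 'b::monoid_add"
  assumes "P 0" "\<And>k a. P (Poly_Mapping.single k a)" "\<And>f g. P f \<Longrightarrow> P g \<Longrightarrow> P (f + g)"
  shows "P f"
proof (induction f rule: update_induct)
  case (update f a b)
  then have "Poly_Mapping.update a b f = f + Poly_Mapping.single a b"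
    by (intro poly_mapping_eqI) (auto simp: lookup_update lookup_add lookup_single in_keys_iff when_def)
  then show ?case
    using update assms by simp
qed (rule assms)


section \<open>A right module for the algebra\<close>

text \<open>On polynomials in \<open>\<alpha>, \<beta>\<close> let \<open>D\<close> act from the right as multiplication by \<open>\<beta>\<close> and let
  \<open>1 \<cdot> E = \<alpha>\<close>; the relation then forces
  \<open>(\<beta> p) \<cdot> E = p \<cdot> DE = (q \<beta> + 1) (p \<cdot> E) + \<beta> p\<close>, which is the recursion behind \<open>act_E\<close>.
  As \<open>1 \<cdot> E\<^sup>iD\<^sup>j = \<alpha>\<^sup>i\<beta>\<^sup>j\<close>, acting on \<open>1\<close> both separates normal forms and computes \<open>Zbar\<close>.\<close>

lemma zyq_embed_simps [simp]:
  "zyq_embed 0 = 0" "zyq_embed 1 = 1"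
  "zyq_embed (a + b) = zyq_embed a + zyq_embed b"
  "zyq_embed (a * b) = zyq_embed a * zyq_embed b"
  by (simp_all add: zyq_embed_def one_pCons)

definition act_E :: "zabyq \<Rightarrow> zabyq" where
  "act_E p = snd (fold_coeffs
     (\<lambda>a (p, r). (pCons a p, [:a:] * alpha_ind + (zyq_embed q_ind * beta_ind + 1) * r + beta_ind * p)) p (0, 0))"

lemma act_E_0 [simp]: "act_E 0 = 0"
  by (simp add: act_E_def)

lemma act_E_pCons:
  "act_E (pCons a p) = [:a:] * alpha_ind + (zyq_embed q_ind * beta_ind + 1) * act_E p + beta_ind * p"
proof -
  let ?f = "\<lambda>a (p, r). (pCons a p, [:a:] * alpha_ind + (zyq_embed q_ind * beta_ind + 1) * r + beta_ind * p)"
  have step: "fold_coeffs ?f (pCons a p) (0, 0) = ?f a (fold_coeffs ?f p (0, 0))" for a p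
    by (cases "p = 0"; cases "a = 0") auto
  have fst_step: "fst (?f a z) = pCons a (fst z)" for a z
    by (cases z) simp
  have fst: "fst (fold_coeffs ?f p (0, 0)) = p" for p
    by (induction p) (simp_all only: step fst_step, simp)
  show ?thesis
    unfolding act_E_def step using fst[of p] by (simp add: case_prod_beta)
qed

lemma act_E_add: "act_E (p + r) = act_E p + act_E r"
proof (induction p r rule: poly_induct2)
  case (pCons a p b r)
  have "act_E (pCons a p + pCons b r) = [:a + b:] * alpha_ind
      + (zyq_embed q_ind * beta_ind + 1) * act_E (p + r) + beta_ind * (p + r)"
    by (simp only: add_pCons act_E_pCons)
  also have "[:a + b:] = [:a:] + [:b:]"
    by simp
  finally show ?case
    unfolding act_E_pCons pCons.IH by (simp only: algebra_simps)
qed simp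

lemma act_E_const_mult: "act_E ([:c:] * p) = [:c:] * act_E p"
proof (induction p)
  case (pCons a p)
  have "act_E ([:c:] * pCons a p) = [:c * a:] * alpha_ind
      + (zyq_embed q_ind * beta_ind + 1) * act_E ([:c:] * p) + beta_ind * ([:c:] * p)"
    by (simp add: act_E_pCons mult.commute)
  also have "[:c * a:] = [:c:] * [:a:]"
    by simp
  finally show ?case
    unfolding act_E_pCons pCons.IH by (simp only: algebra_simps)
qed simp

lemma act_E_zyq_embed_mult: "act_E (zyq_embed c * p) = zyq_embed c * act_E p"
  unfolding zyq_embed_def by (rule act_E_const_mult)

lemma act_E_alpha_mult: "act_E (alpha_ind * p) = alpha_ind * act_E p"
  unfolding alpha_ind_def by (rule act_E_const_mult)

lemma act_E_beta_mult:
  "act_E (beta_ind * p) = (zyq_embed q_ind * beta_ind + 1) * act_E p + beta_ind * p"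
  using act_E_pCons[of 0 p] by (simp add: beta_ind_def)

lemma act_E_1: "act_E 1 = alpha_ind"
  using act_E_pCons[of 1 0] by (simp flip: one_pCons)

fun letter_act :: "letter \<Rightarrow> zabyq \<Rightarrow> zabyq" where
  "letter_act Letter_D p = beta_ind * p"
| "letter_act Letter_E p = act_E p"

lemma letter_act_add: "letter_act l (p + r) = letter_act l p + letter_act l r"
  by (cases l) (simp_all add: act_E_add algebra_simps)

lemma letter_act_zyq_embed_mult: "letter_act l (zyq_embed c * p) = zyq_embed c * letter_act l p"
  by (cases l) (simp_all add: act_E_zyq_embed_mult mult.left_commute)

lemma letter_act_alpha_mult: "letter_act l (alpha_ind * p) = alpha_ind * letter_act l p"
  by (cases l) (simp_all add: act_E_alpha_mult mult.left_commute)

definition word_act :: "word \<Rightarrow> zabyq \<Rightarrow> zabyq" where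
  "word_act w = fold letter_act (letters w)"

lemma word_act_plus: "word_act (u + v) p = word_act v (word_act u p)"
  by (simp add: word_act_def plus_word_def)

lemma fold_letter_act:
  "fold letter_act ls (p + r) = fold letter_act ls p + fold letter_act ls r"
  "fold letter_act ls (zyq_embed c * p) = zyq_embed c * fold letter_act ls p"
  "fold letter_act ls (alpha_ind * p) = alpha_ind * fold letter_act ls p"
  by (induction ls arbitrary: p r)
    (simp_all add: letter_act_add letter_act_zyq_embed_mult letter_act_alpha_mult)

lemmas word_act_add = fold_letter_act(1)[of "letters w" for w, folded word_act_def]
  and word_act_zyq_embed_mult = fold_letter_act(2)[of "letters w" for w, folded word_act_def]
  and word_act_alpha_mult = fold_letter_act(3)[of "letters w" for w, folded word_act_def]

definition free_act :: "free_alg \<Rightarrow> zabyq \<Rightarrow> zabyq" where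
  "free_act f p = lin_ext (\<lambda>w c. zyq_embed c * word_act w p) f"

lemma free_act_0 [simp]: "free_act 0 p = 0"
  by (simp add: free_act_def)

lemma free_act_add: "free_act (f + g) p = free_act f p + free_act g p"
  unfolding free_act_def by (rule lin_ext_add) (simp_all add: algebra_simps)

lemma free_act_single: "free_act (Poly_Mapping.single w c) p = zyq_embed c * word_act w p"
  unfolding free_act_def by (rule lin_ext_single) simp

lemma free_act_add_right: "free_act f (p + r) = free_act f p + free_act f r"
  by (induction f rule: poly_mapping_add_induct)
    (simp_all add: free_act_add free_act_single word_act_add algebra_simps)

lemma free_act_zyq_embed_mult: "free_act f (zyq_embed c * p) = zyq_embed c * free_act f p"
  by (induction f rule: poly_mapping_add_induct)
    (simp_all add: free_act_add free_act_single word_act_zyq_embed_mult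
      distrib_left mult.left_commute)

lemma free_act_alpha_mult: "free_act f (alpha_ind * p) = alpha_ind * free_act f p"
  by (induction f rule: poly_mapping_add_induct)
    (simp_all add: free_act_add free_act_single word_act_alpha_mult
      distrib_left mult.left_commute)

lemma free_act_0_right [simp]: "free_act f 0 = 0"
  using free_act_add_right[of f 0 0] by simp

lemma free_act_mult: "free_act (f * g) p = free_act g (free_act f p)"
proof (induction f rule: poly_mapping_add_induct)
  case (single u a)
  show ?case
    by (induction g rule: poly_mapping_add_induct)
      (simp_all add: free_act_add free_act_single mult_single word_act_plus
        word_act_zyq_embed_mult algebra_simps)
qed (simp_all add: free_act_add free_act_add_right algebra_simps)

lemma free_act_gens:
  "free_act free_D p = beta_ind * p" "free_act free_E p = act_E p"
  "free_act (free_scalar c) p = zyq_embed c * p" "free_act 1 p = p"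
  by (simp_all add: free_D_def free_E_def free_scalar_def free_act_single word_act_def zero_word_def
      flip: single_one)

lemma free_act_uminus: "free_act (- f) p = - free_act f p"
  using free_act_add[of f "- f" p] by (simp add: eq_neg_iff_add_eq_0 add.commute)

lemma free_act_diff: "free_act (f - g) p = free_act f p - free_act g p"
  using free_act_add[of f "- g" p] by (simp add: free_act_uminus)

lemma free_act_pasep_ideal:
  assumes "x \<in> pasep_ideal"
  shows "free_act x p = 0"
  using assms unfolding pasep_ideal_def
proof (induction arbitrary: p)
  case (gen x)
  then have x: "x = free_D * free_E - free_scalar q_ind * free_E * free_D - (free_D + free_E)"
    by simp
  show ?case
    unfolding x free_act_diff free_act_add free_act_mult free_act_gens act_E_beta_mult
      act_E_zyq_embed_mult by (simp add: algebra_simps)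
qed (simp_all add: free_act_add free_act_mult)

lift_definition pasep_eval :: "pasep_alg \<Rightarrow> zabyq" is "\<lambda>f. free_act f 1"
  using free_act_pasep_ideal by (simp add: pasep_rel_def) (metis eq_iff_diff_eq_0 free_act_diff)

lemma pasep_eval_0 [simp]: "pasep_eval 0 = 0"
  by transfer simp

lemma pasep_eval_1 [simp]: "pasep_eval 1 = 1"
  by transfer (simp add: free_act_gens)

lemma pasep_eval_add: "pasep_eval (x + y) = pasep_eval x + pasep_eval y"
  by transfer (simp add: free_act_add)

lemma pasep_eval_sum: "pasep_eval (sum f A) = (\<Sum>x\<in>A. pasep_eval (f x))"
  by (induction A rule: infinite_finite_induct) (simp_all add: pasep_eval_add)

lemma pasep_eval_scalar_mult: "pasep_eval (scalar c * x) = zyq_embed c * pasep_eval x"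
proof transfer
  fix c f
  show "free_act (free_scalar c * f) 1 = zyq_embed c * free_act f 1"
    using free_act_zyq_embed_mult[of f c 1] by (simp add: free_act_mult free_act_gens)
qed

lemma pasep_eval_E_mult: "pasep_eval (gen_E * x) = alpha_ind * pasep_eval x"
proof transfer
  fix f
  show "free_act (free_E * f) 1 = alpha_ind * free_act f 1"
    using free_act_alpha_mult[of f 1] by (simp add: free_act_mult free_act_gens act_E_1)
qed

lemma pasep_eval_mult_D: "pasep_eval (x * gen_D) = beta_ind * pasep_eval x"
  by transfer (simp add: free_act_mult free_act_gens)

lemma pasep_eval_monomial:
  "pasep_eval (scalar c * gen_E ^ i * gen_D ^ j) = zyq_embed c * alpha_ind ^ i * beta_ind ^ j"
proof -
  have D: "pasep_eval (x * gen_D ^ j) = beta_ind ^ j * pasep_eval x" for x j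
  proof (induction j)
    case (Suc j)
    have "pasep_eval (x * gen_D ^ Suc j) = pasep_eval (x * gen_D ^ j * gen_D)"
      by (simp add: power_Suc2 mult.assoc del: power_Suc)
    also have "\<dots> = beta_ind * (beta_ind ^ j * pasep_eval x)"
      unfolding pasep_eval_mult_D Suc ..
    finally show ?case
      by (simp add: mult.assoc)
  qed simp
  have E: "pasep_eval (gen_E ^ i) = alpha_ind ^ i" for i
    by (induction i) (simp_all add: pasep_eval_E_mult)
  show ?thesis
    unfolding D by (simp add: E pasep_eval_scalar_mult)
qed


section \<open>Normal forms\<close>

lemma gen_D_gen_E: "gen_D * gen_E = scalar q_ind * gen_E * gen_D + gen_D + gen_E"
  by transfer (auto simp: pasep_rel_def pasep_ideal_def diff_diff_eq add.assoc
      intro!: two_sided_ideal.gen)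

lemma free_scalar_commute: "free_scalar c * f = f * free_scalar c"
  by (induction f rule: poly_mapping_add_induct)
    (simp_all add: free_scalar_def mult_single algebra_simps)

lemma scalar_commute: "scalar c * x = x * scalar c"
  by transfer (simp add: free_scalar_commute equivp_reflp[OF equivp_pasep_rel])

lemma scalar_left_commute: "x * (scalar c * z) = scalar c * (x * z)"
  by (metis mult.assoc scalar_commute)

lemma scalar_simps [simp]:
  "scalar 0 = 0" "scalar 1 = 1" "scalar (a + b) = scalar a + scalar b"
  "scalar (a * b) = scalar a * scalar b"
proof -
  note free_scalar_simps = free_scalar_def single_add mult_single equivp_reflp[OF equivp_pasep_rel]
  show "scalar 0 = 0" by transfer (simp add: free_scalar_simps)
  show "scalar 1 = 1" by transfer (simp add: free_scalar_simps)
  show "scalar (a + b) = scalar a + scalar b" by transfer (simp add: free_scalar_simps)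
  show "scalar (a * b) = scalar a * scalar b" by transfer (simp add: free_scalar_simps)
qed

definition nf_sum :: "((nat \<times> nat) \<Rightarrow>\<^sub>0 zyq) \<Rightarrow> pasep_alg" where
  "nf_sum = lin_ext (\<lambda>(i, j) c. scalar c * gen_E ^ i * gen_D ^ j)"

lemma nf_sum_add: "nf_sum (c + d) = nf_sum c + nf_sum d"
  unfolding nf_sum_def by (rule lin_ext_add) (auto simp: algebra_simps)

lemma nf_sum_single: "nf_sum (Poly_Mapping.single (i, j) c) = scalar c * gen_E ^ i * gen_D ^ j"
  unfolding nf_sum_def by (subst lin_ext_single) auto

lemma pasep_eval_nf_sum:
  "pasep_eval (nf_sum c) = lin_ext (\<lambda>(i, j) a. zyq_embed a * alpha_ind ^ i * beta_ind ^ j) c"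
  by (simp add: nf_sum_def lin_ext_def pasep_eval_sum pasep_eval_monomial case_prod_beta)

lemma coeff_monomial_alpha_beta:
  "coeff (coeff (zyq_embed a * alpha_ind ^ i * beta_ind ^ j) j') i' = (a when (i, j) = (i', j'))"
proof -
  have "alpha_ind ^ i = [:monom 1 i:]" "beta_ind ^ j = monom 1 j"
    by (simp_all add: alpha_ind_def beta_ind_def monom_altdef poly_const_pow)
  then show ?thesis
    by (simp add: zyq_embed_def smult_monom)
qed

lemma inj_nf_sum: "inj nf_sum"
proof -
  have "coeff (coeff (pasep_eval (nf_sum c)) j) i = Poly_Mapping.lookup c (i, j)" for c i j
  proof (induction c rule: poly_mapping_add_induct)
    case (single k a)
    then show ?case
      by (cases k) (simp add: nf_sum_single pasep_eval_monomial coeff_monomial_alpha_beta lookup_single)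
  qed (simp_all add: nf_sum_add pasep_eval_add lookup_add, simp add: nf_sum_def)
  then show ?thesis
    by (intro injI poly_mapping_eqI) (metis surj_pair)
qed

lemma range_nf_sum_add: "x \<in> range nf_sum \<Longrightarrow> y \<in> range nf_sum \<Longrightarrow> x + y \<in> range nf_sum"
  by (auto simp flip: nf_sum_add)

lemma range_nf_sum_linear:
  assumes "\<And>x y. f (x + y) = f x + f y" "f 0 = 0"
    and "\<And>c i j. f (scalar c * gen_E ^ i * gen_D ^ j) \<in> range nf_sum"
    and "x \<in> range nf_sum"
  shows "f x \<in> range nf_sum"
proof -
  have "f (nf_sum c) \<in> range nf_sum" for c
  proof (induction c rule: poly_mapping_add_induct)
    case zero
    then show ?case
      using assms(2) by (simp add: nf_sum_def range_eqI[of _ _ 0])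
  next
    case (single k a)
    then show ?case
      using assms(3) by (cases k) (simp add: nf_sum_single)
  next
    case (add c d)
    then show ?case
      by (simp add: nf_sum_add assms(1) range_nf_sum_add)
  qed
  then show ?thesis
    using assms(4) by auto
qed

lemma range_nf_sum_monomial: "scalar c * gen_E ^ i * gen_D ^ j \<in> range nf_sum"
  by (metis nf_sum_single rangeI)

lemma range_nf_sum_scalar_mult: "x \<in> range nf_sum \<Longrightarrow> scalar c * x \<in> range nf_sum"
  by (erule range_nf_sum_linear[rotated 3])
    (simp_all add: distrib_left range_nf_sum_monomial flip: mult.assoc scalar_simps(4))

lemma range_nf_sum_E_mult: "x \<in> range nf_sum \<Longrightarrow> gen_E * x \<in> range nf_sum"
proof (erule range_nf_sum_linear[rotated 3])
  show "gen_E * (scalar c * gen_E ^ i * gen_D ^ j) \<in> range nf_sum" for c i j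
    using range_nf_sum_monomial[of c "Suc i" j]
    by (simp add: mult.assoc scalar_left_commute[of gen_E])
qed (simp_all add: distrib_left)

lemma range_nf_sum_D_mult: "x \<in> range nf_sum \<Longrightarrow> gen_D * x \<in> range nf_sum"
proof (erule range_nf_sum_linear[rotated 3])
  have "gen_D * (gen_E ^ i * gen_D ^ j) \<in> range nf_sum" for i j
  proof (induction i)
    case 0
    show ?case
      using range_nf_sum_monomial[of 1 0 "Suc j"] by simp
  next
    case (Suc i)
    let ?m = "gen_E ^ i * gen_D ^ j"
    have "gen_D * (gen_E ^ Suc i * gen_D ^ j) = (gen_D * gen_E) * ?m"
      by (simp add: mult.assoc)
    also have "\<dots> = scalar q_ind * (gen_E * (gen_D * ?m)) + gen_D * ?m + gen_E * ?m"
      unfolding gen_D_gen_E by (simp add: algebra_simps)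
    also have "\<dots> \<in> range nf_sum"
      using Suc range_nf_sum_monomial[of 1 i j]
      by (simp add: range_nf_sum_add range_nf_sum_scalar_mult range_nf_sum_E_mult)
    finally show ?case .
  qed
  then show "gen_D * (scalar c * gen_E ^ i * gen_D ^ j) \<in> range nf_sum" for c i j
    by (simp add: mult.assoc scalar_left_commute[of gen_D] range_nf_sum_scalar_mult)
qed (simp_all add: distrib_left)

lemma Zbar_eq_pasep_eval: "Zbar N = pasep_eval ((scalar y_ind * gen_D + gen_E) ^ N)"
proof -
  let ?x = "(scalar y_ind * gen_D + gen_E) ^ N"
  have "?x \<in> range nf_sum"
  proof (induction N)
    case 0
    show ?case
      using range_nf_sum_monomial[of 1 0 0] by simp
  next
    case (Suc N)
    then show ?case
      by (simp add: distrib_right mult.assoc range_nf_sum_add range_nf_sum_scalar_mult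
          range_nf_sum_E_mult range_nf_sum_D_mult)
  qed
  then obtain c where c: "?x = nf_sum c"
    by blast
  have "nf_sum c = (\<Sum>(i, j)\<in>Poly_Mapping.keys c.
      scalar (Poly_Mapping.lookup c (i, j)) * gen_E ^ i * gen_D ^ j)" for c
    by (simp add: nf_sum_def lin_ext_def case_prod_beta)
  then have "normal_form ?x = (THE d. nf_sum c = nf_sum d)"
    unfolding normal_form_def c by (simp add: case_prod_beta)
  also have "\<dots> = c"
    using inj_nf_sum by (auto dest: injD)
  finally show ?thesis
    using pasep_eval_nf_sum[of c] c
    by (simp add: Zbar_def pasep_coeffs_def lin_ext_def case_prod_beta)
qed


section \<open>Prepending a letter to a permutation\<close>

definition shift_above :: "nat \<Rightarrow> nat \<Rightarrow> nat" where
  "shift_above r v = (if v < r then v else Suc v)"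

lemma shift_above_simps [simp]:
  "shift_above r a \<le> shift_above r b \<longleftrightarrow> a \<le> b"
  "shift_above r a < shift_above r b \<longleftrightarrow> a < b"
  "shift_above r a = shift_above r b \<longleftrightarrow> a = b"
  "shift_above r a < r \<longleftrightarrow> a < r"
  "shift_above r a \<le> r \<longleftrightarrow> a < r"
  "r < shift_above r a \<longleftrightarrow> r \<le> a"
  "r \<le> shift_above r a \<longleftrightarrow> r \<le> a"
  "shift_above r a \<noteq> r"
  "r \<noteq> shift_above r a"
  by (auto simp: shift_above_def)

definition prepend :: "nat \<Rightarrow> nat \<Rightarrow> (nat \<Rightarrow> nat) \<Rightarrow> nat \<Rightarrow> nat" where
  "prepend n r \<tau> i =
     (if i = 1 then r else if i \<in> {2..n + 1} then shift_above r (\<tau> (i - 1)) else i)"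

lemma prepend_1 [simp]: "prepend n r \<tau> (Suc 0) = r"
  by (simp add: prepend_def)

lemma prepend_Suc [simp]: "i \<in> {1..n} \<Longrightarrow> prepend n r \<tau> (Suc i) = shift_above r (\<tau> i)"
  by (auto simp: prepend_def)

lemma atLeastAtMost_1_Suc: "{1..Suc n} = insert 1 (Suc ` {1..n})"
  unfolding image_Suc_atLeastAtMost by auto

lemma prepend_permutes:
  assumes \<tau>: "\<tau> permutes {1..n}" and r: "r \<in> {1..n + 1}"
  shows "prepend n r \<tau> permutes {1..n + 1}"
proof (rule bij_imp_permutes)
  have \<tau>_in: "\<tau> i \<in> {1..n}" if "i \<in> {1..n}" for i
    using permutes_in_image[OF \<tau>] that by blast
  have inj: "inj_on (prepend n r \<tau>) {1..n + 1}"
    unfolding Suc_eq_plus1[symmetric] atLeastAtMost_1_Suc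
    using permutes_inj[OF \<tau>]
    by (auto simp: inj_on_def simp del: image_Suc_atLeastAtMost dest: injD)
  have "prepend n r \<tau> ` {1..n + 1} \<subseteq> {1..n + 1}"
  proof
    fix v assume "v \<in> prepend n r \<tau> ` {1..n + 1}"
    then obtain i where "v = r \<or> i \<in> {1..n} \<and> v = shift_above r (\<tau> i)"
      unfolding Suc_eq_plus1[symmetric] atLeastAtMost_1_Suc
      by (auto simp del: image_Suc_atLeastAtMost)
    then show "v \<in> {1..n + 1}"
      using r \<tau>_in[of i] by (auto simp: shift_above_def)
  qed
  then show "bij_betw (prepend n r \<tau>) {1..n + 1} {1..n + 1}"
    using inj by (simp add: bij_betw_def endo_inj_surj)
qed (auto simp: prepend_def)

lemma inj_on_prepend:
  "inj_on (\<lambda>(r, \<tau>). prepend n r \<tau>) ({1..n + 1} \<times> {\<tau>. \<tau> permutes {1..n}})"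
proof (rule inj_onI, clarify)
  fix r r' \<tau> \<tau>'
  assume \<tau>: "\<tau> permutes {1..n}" "\<tau>' permutes {1..n}" and eq: "prepend n r \<tau> = prepend n r' \<tau>'"
  from fun_cong[OF eq, of "Suc 0"] have r: "r = r'"
    by simp
  have "\<tau> i = \<tau>' i" for i
  proof (cases "i \<in> {1..n}")
    case True
    then show ?thesis
      using fun_cong[OF eq, of "Suc i"] r by simp
  next
    case False
    then show ?thesis
      using permutes_not_in[OF \<tau>(1) False] permutes_not_in[OF \<tau>(2) False] by simp
  qed
  with r show "r = r' \<and> \<tau> = \<tau>'"
    by auto
qed

lemma prepend_image:
  "(\<lambda>(r, \<tau>). prepend n r \<tau>) ` ({1..n + 1} \<times> {\<tau>. \<tau> permutes {1..n}}) =
    {\<sigma>. \<sigma> permutes {1..n + 1}}"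
proof (rule card_subset_eq)
  show "finite {\<sigma>. \<sigma> permutes {1..n + 1}}"
    by (simp add: finite_permutations)
  show "(\<lambda>(r, \<tau>). prepend n r \<tau>) ` ({1..n + 1} \<times> {\<tau>. \<tau> permutes {1..n}})
      \<subseteq> {\<sigma>. \<sigma> permutes {1..n + 1}}"
    using prepend_permutes by auto
  have "card {\<sigma>. \<sigma> permutes {1..m}} = fact m" for m :: nat
    by (rule card_permutations) simp_all
  then show "card ((\<lambda>(r, \<tau>). prepend n r \<tau>) ` ({1..n + 1} \<times> {\<tau>. \<tau> permutes {1..n}})) =
      card {\<sigma>. \<sigma> permutes {1..n + 1}}"
    unfolding card_image[OF inj_on_prepend] card_cartesian_product by simp
qed

lemma bij_betw_prepend:
  assumes "r \<in> {1..n + 1}"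
  shows "bij_betw (prepend n r) {\<tau>. \<tau> permutes {1..n}} {\<sigma>. \<sigma> permutes {1..n + 1} \<and> \<sigma> 1 = r}"
  unfolding bij_betw_def
proof
  show "inj_on (prepend n r) {\<tau>. \<tau> permutes {1..n}}"
    using inj_on_prepend[of n] assms by (force simp: inj_on_def)
  show "prepend n r ` {\<tau>. \<tau> permutes {1..n}} = {\<sigma>. \<sigma> permutes {1..n + 1} \<and> \<sigma> 1 = r}"
  proof (intro equalityI subsetI)
    fix \<sigma> assume \<sigma>: "\<sigma> \<in> {\<sigma>. \<sigma> permutes {1..n + 1} \<and> \<sigma> 1 = r}"
    then have "\<sigma> \<in> (\<lambda>(r, \<tau>). prepend n r \<tau>) ` ({1..n + 1} \<times> {\<tau>. \<tau> permutes {1..n}})"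
      unfolding prepend_image by simp
    then obtain r' \<tau> where "\<sigma> = prepend n r' \<tau>" "\<tau> permutes {1..n}"
      by auto
    with \<sigma> show "\<sigma> \<in> prepend n r ` {\<tau>. \<tau> permutes {1..n}}"
      by auto
  qed (use prepend_permutes[of _ n r] assms in auto)
qed

lemma card_filter_atLeastAtMost_1_Suc:
  "card {j \<in> {1..Suc n}. P j} = of_bool (P 1) + card {j \<in> {1..n}. P (Suc j)}"
proof -
  have "{j \<in> {1..Suc n}. P j} = {j. j = 1 \<and> P 1} \<union> Suc ` {j \<in> {1..n}. P (Suc j)}"
    unfolding atLeastAtMost_1_Suc by (auto simp del: image_Suc_atLeastAtMost)
  moreover have "card {j. j = (1::nat) \<and> P 1} = of_bool (P 1)"
    by (cases "P 1") auto
  moreover have "card ({j. j = 1 \<and> P 1} \<union> Suc ` {j \<in> {1..n}. P (Suc j)}) =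
      card {j. j = (1::nat) \<and> P 1} + card (Suc ` {j \<in> {1..n}. P (Suc j)})"
    by (rule card_Un_disjoint) auto
  ultimately show ?thesis
    by (simp add: card_image)
qed

lemma rl_maxima_altdef: "rl_maxima n \<sigma> = card {j \<in> {1..n}. \<forall>l\<in>{j..n}. \<sigma> l \<le> \<sigma> j}"
  unfolding rl_maxima_def
proof (intro arg_cong[where f = card] Collect_cong conj_cong refl)
  fix j assume "j \<in> {1..n}"
  then show "\<sigma> j = Max (\<sigma> ` {j..n}) \<longleftrightarrow> (\<forall>l\<in>{j..n}. \<sigma> l \<le> \<sigma> j)"
    by (subst eq_Max_iff) auto
qed

lemma rl_minima_altdef: "rl_minima n \<sigma> = card {j \<in> {1..n}. \<forall>l\<in>{j..n}. \<sigma> j \<le> \<sigma> l}"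
  unfolding rl_minima_def
proof (intro arg_cong[where f = card] Collect_cong conj_cong refl)
  fix j assume "j \<in> {1..n}"
  then show "\<sigma> j = Min (\<sigma> ` {j..n}) \<longleftrightarrow> (\<forall>l\<in>{j..n}. \<sigma> j \<le> \<sigma> l)"
    by (subst eq_Min_iff) auto
qed

lemma pattern_31_2_altdef:
  "pattern_31_2 n \<sigma> =
    (\<Sum>i = 1..n. card {j \<in> {1..n}. i + 1 < j \<and> \<sigma> (i + 1) < \<sigma> j \<and> \<sigma> j < \<sigma> i})"
proof -
  let ?J = "\<lambda>i. {j \<in> {1..n}. i + 1 < j \<and> \<sigma> (i + 1) < \<sigma> j \<and> \<sigma> j < \<sigma> i}"
  have "{(i, i + 1, j) | i j. 1 \<le> i \<and> i + 1 < j \<and> j \<le> n \<and> \<sigma> (i + 1) < \<sigma> j \<and> \<sigma> j < \<sigma> i} =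
      (\<lambda>(i, j). (i, i + 1, j)) ` (SIGMA i:{1..n}. ?J i)"
    by (auto simp: image_iff)
  then show ?thesis
    unfolding pattern_31_2_def by (simp add: card_image inj_on_def card_SigmaI)
qed

lemma permutes_ball:
  assumes "p permutes S"
  shows "(\<forall>x\<in>S. P (p x)) \<longleftrightarrow> (\<forall>x\<in>S. P x)"
proof -
  have "(\<forall>x\<in>p ` S. P x) \<longleftrightarrow> (\<forall>x\<in>S. P (p x))"
    by simp
  then show ?thesis
    by (simp only: permutes_image[OF assms])
qed

context
  fixes n r :: nat and \<tau> :: "nat \<Rightarrow> nat"
  assumes n: "n \<ge> 1" and \<tau>: "\<tau> permutes {1..n}" and r: "r \<in> {1..n + 1}"
begin

lemma rl_maxima_prepend:
  "rl_maxima (n + 1) (prepend n r \<tau>) = of_bool (r = n + 1) + rl_maxima n \<tau>"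
proof -
  have "(\<forall>l\<in>{1..Suc n}. prepend n r \<tau> l \<le> prepend n r \<tau> 1) \<longleftrightarrow> (\<forall>l\<in>{1..n}. \<tau> l < r)"
    unfolding atLeastAtMost_1_Suc by (auto simp del: image_Suc_atLeastAtMost)
  also have "\<dots> \<longleftrightarrow> r = n + 1"
    unfolding permutes_ball[OF \<tau>, of "\<lambda>v. v < r"] using r n by force
  finally have first: "(\<forall>l\<in>{1..Suc n}. prepend n r \<tau> l \<le> prepend n r \<tau> 1) \<longleftrightarrow> r = n + 1" .
  have rest: "(\<forall>l\<in>{Suc j..Suc n}. prepend n r \<tau> l \<le> prepend n r \<tau> (Suc j)) \<longleftrightarrow>
      (\<forall>l\<in>{j..n}. \<tau> l \<le> \<tau> j)" if "j \<in> {1..n}" for j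
    unfolding image_Suc_atLeastAtMost[symmetric] ball_simps
    using that by (intro ball_cong refl) simp
  show ?thesis
    unfolding rl_maxima_altdef Suc_eq_plus1[symmetric] card_filter_atLeastAtMost_1_Suc first
    using rest by (simp cong: conj_cong)
qed

lemma rl_minima_prepend:
  "rl_minima (n + 1) (prepend n r \<tau>) = of_bool (r = 1) + rl_minima n \<tau>"
proof -
  have "(\<forall>l\<in>{1..Suc n}. prepend n r \<tau> 1 \<le> prepend n r \<tau> l) \<longleftrightarrow> (\<forall>l\<in>{1..n}. r \<le> \<tau> l)"
    unfolding atLeastAtMost_1_Suc by (auto simp del: image_Suc_atLeastAtMost)
  also have "\<dots> \<longleftrightarrow> r = 1"
    unfolding permutes_ball[OF \<tau>, of "\<lambda>v. r \<le> v"] using r n by (auto dest: bspec[of _ _ 1])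
  finally have first: "(\<forall>l\<in>{1..Suc n}. prepend n r \<tau> 1 \<le> prepend n r \<tau> l) \<longleftrightarrow> r = 1" .
  have rest: "(\<forall>l\<in>{Suc j..Suc n}. prepend n r \<tau> (Suc j) \<le> prepend n r \<tau> l) \<longleftrightarrow>
      (\<forall>l\<in>{j..n}. \<tau> j \<le> \<tau> l)" if "j \<in> {1..n}" for j
    unfolding image_Suc_atLeastAtMost[symmetric] ball_simps
    using that by (intro ball_cong refl) simp
  show ?thesis
    unfolding rl_minima_altdef Suc_eq_plus1[symmetric] card_filter_atLeastAtMost_1_Suc first
    using rest by (simp cong: conj_cong)
qed

lemma asc_prepend: "asc (n + 1) (prepend n r \<tau>) = of_bool (r \<le> \<tau> 1) + asc n \<tau>"
proof -
  have first: "(1 = Suc n \<or> prepend n r \<tau> 1 < prepend n r \<tau> (1 + 1)) \<longleftrightarrow> r \<le> \<tau> 1"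
    using n prepend_Suc[of 1 n r \<tau>] by simp
  have rest: "(Suc j = Suc n \<or> prepend n r \<tau> (Suc j) < prepend n r \<tau> (Suc j + 1)) \<longleftrightarrow>
      (j = n \<or> \<tau> j < \<tau> (j + 1))" if "j \<in> {1..n}" for j
    using that prepend_Suc[of j n r \<tau>] prepend_Suc[of "Suc j" n r \<tau>] by (cases "j = n") simp_all
  show ?thesis
    unfolding asc_def Suc_eq_plus1[symmetric] card_filter_atLeastAtMost_1_Suc
    unfolding Suc_eq_plus1 first[unfolded Suc_eq_plus1]
    using rest by (simp cong: conj_cong)
qed

lemma pattern_31_2_prepend:
  "pattern_31_2 (n + 1) (prepend n r \<tau>) = (r - 1 - \<tau> 1) + pattern_31_2 n \<tau>"
proof -
  let ?\<sigma> = "prepend n r \<tau>"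
  let ?J = "\<lambda>n \<sigma> i. {j \<in> {1..n}. i + 1 < j \<and> \<sigma> (i + 1) < \<sigma> j \<and> \<sigma> j < \<sigma> i}"
  have "card (?J (Suc n) ?\<sigma> 1) = card {j \<in> {1..n}. \<tau> 1 < \<tau> j \<and> \<tau> j < r}"
  proof -
    have "(1 + 1 < Suc j \<and> ?\<sigma> (1 + 1) < ?\<sigma> (Suc j) \<and> ?\<sigma> (Suc j) < ?\<sigma> 1) \<longleftrightarrow>
        \<tau> 1 < \<tau> j \<and> \<tau> j < r" if "j \<in> {1..n}" for j
      using that n prepend_Suc[of 1 n r \<tau>] prepend_Suc[of j n r \<tau>] by (cases "j = 1") auto
    then show ?thesis
      unfolding card_filter_atLeastAtMost_1_Suc by (simp cong: conj_cong)
  qed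
  also have "\<dots> = card (\<tau> ` {j \<in> {1..n}. \<tau> 1 < \<tau> j \<and> \<tau> j < r})"
    using permutes_inj[OF \<tau>] by (intro card_image[symmetric]) (auto simp: inj_on_def)
  also have "\<tau> ` {j \<in> {1..n}. \<tau> 1 < \<tau> j \<and> \<tau> j < r} = {v \<in> \<tau> ` {1..n}. \<tau> 1 < v \<and> v < r}"
    by blast
  also have "\<dots> = {\<tau> 1<..<r}"
    unfolding permutes_image[OF \<tau>] using r by auto
  finally have first: "card (?J (Suc n) ?\<sigma> 1) = r - 1 - \<tau> 1"
    by simp
  have rest: "card (?J (Suc n) ?\<sigma> (Suc i)) = card (?J n \<tau> i)" if "i \<in> {1..n}" for i
  proof -
    have "(Suc i + 1 < Suc j \<and> ?\<sigma> (Suc i + 1) < ?\<sigma> (Suc j) \<and> ?\<sigma> (Suc j) < ?\<sigma> (Suc i)) \<longleftrightarrow>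
        (i + 1 < j \<and> \<tau> (i + 1) < \<tau> j \<and> \<tau> j < \<tau> i)" if "j \<in> {1..n}" for j
      using that \<open>i \<in> {1..n}\<close> prepend_Suc[of i n r \<tau>] prepend_Suc[of "Suc i" n r \<tau>]
        prepend_Suc[of j n r \<tau>]
      by (cases "i + 1 < j") auto
    then show ?thesis
      unfolding card_filter_atLeastAtMost_1_Suc by (simp cong: conj_cong)
  qed
  have "pattern_31_2 (n + 1) ?\<sigma> =
      card (?J (Suc n) ?\<sigma> 1) + (\<Sum>i\<in>Suc ` {1..n}. card (?J (Suc n) ?\<sigma> i))"
    unfolding pattern_31_2_altdef Suc_eq_plus1[symmetric] atLeastAtMost_1_Suc[of n]
    by (subst sum.insert) auto
  also have "\<dots> = (r - 1 - \<tau> 1) + (\<Sum>i = 1..n. card (?J n \<tau> i))"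
    unfolding first sum.reindex[OF inj_Suc] o_def using rest by (simp only: cong: sum.cong)
  finally show ?thesis
    unfolding pattern_31_2_altdef .
qed

end

lemma statistics_pos:
  assumes "n \<ge> 1"
  shows "rl_maxima n \<sigma> \<ge> 1" "rl_minima n \<sigma> \<ge> 1" "asc n \<sigma> \<ge> 1"
proof -
  have "card {j \<in> {1..n}. P j} \<ge> 1" if "P n" for P
    using assms that by (auto simp: Suc_le_eq card_gt_0_iff)
  then show "rl_maxima n \<sigma> \<ge> 1" "rl_minima n \<sigma> \<ge> 1" "asc n \<sigma> \<ge> 1"
    unfolding rl_maxima_altdef rl_minima_altdef asc_def by simp_all
qed

definition perm_weight :: "nat \<Rightarrow> (nat \<Rightarrow> nat) \<Rightarrow> zabyq" where
  "perm_weight n \<sigma> =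
     alpha_ind ^ (rl_maxima n \<sigma> - 1) * beta_ind ^ (rl_minima n \<sigma> - 1) *
     zyq_embed y_ind ^ (asc n \<sigma> - 1) * zyq_embed q_ind ^ pattern_31_2 n \<sigma>"

definition first_weight :: "nat \<Rightarrow> nat \<Rightarrow> zabyq" where
  "first_weight n a = (\<Sum>\<sigma> | \<sigma> permutes {1..n} \<and> \<sigma> 1 = a. perm_weight n \<sigma>)"

lemma perm_weight_prepend:
  assumes "n \<ge> 1" "\<tau> permutes {1..n}" "r \<in> {1..n + 1}"
  shows "perm_weight (n + 1) (prepend n r \<tau>) =
    alpha_ind ^ of_bool (r = n + 1) * beta_ind ^ of_bool (r = 1) *
    (zyq_embed y_ind ^ of_bool (r \<le> \<tau> 1) * zyq_embed q_ind ^ (r - 1 - \<tau> 1)) * perm_weight n \<tau>"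
proof -
  have "b + k - 1 = b + (k - 1)" if "k \<ge> 1" for b k :: nat
    using that by simp
  note diff = this[OF statistics_pos(1)[OF assms(1), of \<tau>]]
    this[OF statistics_pos(2)[OF assms(1), of \<tau>]] this[OF statistics_pos(3)[OF assms(1), of \<tau>]]
  show ?thesis
    unfolding perm_weight_def rl_maxima_prepend[OF assms] rl_minima_prepend[OF assms]
      asc_prepend[OF assms] pattern_31_2_prepend[OF assms] diff power_add
    by (simp only: mult_ac)
qed

lemma sum_perm_weight:
  assumes "n \<ge> 1"
  shows "(\<Sum>\<sigma> | \<sigma> permutes {1..n}. f (\<sigma> 1) * perm_weight n \<sigma>) =
    (\<Sum>a = 1..n. f a * first_weight n a)"
proof -
  have "(\<lambda>\<sigma>. \<sigma> 1) ` {\<sigma>. \<sigma> permutes {1..n}} \<subseteq> {1..n}"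
    using assms permutes_in_image[of _ "{1..n}" 1] by force
  then have "(\<Sum>\<sigma> | \<sigma> permutes {1..n}. f (\<sigma> 1) * perm_weight n \<sigma>) =
      (\<Sum>a = 1..n. \<Sum>\<sigma> | \<sigma> \<in> {\<sigma>. \<sigma> permutes {1..n}} \<and> \<sigma> 1 = a. f (\<sigma> 1) * perm_weight n \<sigma>)"
    by (intro sum.group[symmetric]) (simp_all add: finite_permutations)
  then show ?thesis
    by (simp add: first_weight_def sum_distrib_left)
qed

lemma first_weight_1: "first_weight 1 1 = 1"
proof -
  have "{\<sigma>. \<sigma> permutes {1..1::nat} \<and> \<sigma> 1 = 1} = {id}"
    by (auto simp: permutes_sing)
  moreover have "perm_weight 1 id = 1"
    by (simp add: perm_weight_def rl_maxima_altdef rl_minima_altdef asc_def pattern_31_2_altdef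
        Collect_conv_if cong: conj_cong)
  ultimately show ?thesis
    by (simp add: first_weight_def)
qed

lemma first_weight_Suc:
  assumes "n \<ge> 1" "r \<in> {1..n + 1}"
  shows "first_weight (n + 1) r =
    alpha_ind ^ of_bool (r = n + 1) * beta_ind ^ of_bool (r = 1) *
    (zyq_embed y_ind * (\<Sum>a = r..n. first_weight n a) +
     (\<Sum>a = 1..<r. zyq_embed q_ind ^ (r - 1 - a) * first_weight n a))"
proof -
  let ?f = "\<lambda>a. zyq_embed y_ind ^ of_bool (r \<le> a) * zyq_embed q_ind ^ (r - 1 - a)"
  have "first_weight (n + 1) r =
      (\<Sum>\<tau> | \<tau> permutes {1..n}. perm_weight (n + 1) (prepend n r \<tau>))"
    unfolding first_weight_def
    by (rule sum.reindex_bij_betw[OF bij_betw_prepend[OF assms(2)], symmetric])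
  also have "\<dots> = alpha_ind ^ of_bool (r = n + 1) * beta_ind ^ of_bool (r = 1) *
      (\<Sum>\<tau> | \<tau> permutes {1..n}. ?f (\<tau> 1) * perm_weight n \<tau>)"
    unfolding sum_distrib_left
    by (intro sum.cong refl, subst perm_weight_prepend[OF assms(1) _ assms(2)])
      (simp_all only: mem_Collect_eq mult.assoc)
  also have "(\<Sum>\<tau> | \<tau> permutes {1..n}. ?f (\<tau> 1) * perm_weight n \<tau>) =
      (\<Sum>a = 1..n. ?f a * first_weight n a)"
    by (rule sum_perm_weight[OF assms(1)])
  also have "{1..n} = {r..n} \<union> {1..<r}"
    using assms(2) by auto
  also have "(\<Sum>a\<in>{r..n} \<union> {1..<r}. ?f a * first_weight n a) =
      (\<Sum>a = r..n. ?f a * first_weight n a) + (\<Sum>a = 1..<r. ?f a * first_weight n a)"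
    by (rule sum.union_disjoint) auto
  finally show ?thesis
    by (simp add: sum_distrib_left)
qed


section \<open>The corresponding elements of the algebra\<close>

locale pasep_relation =
  fixes D E y q :: "'a::ring_1"
  assumes relation: "D * E = q * E * D + D + E"
    and y_central: "y * x = x * y"
    and q_central: "q * x = x * q"
begin

definition T :: 'a where "T = y * D + E"

definition Q :: 'a where "Q = q * y * D + E"

text \<open>Applied to \<open>slice n r\<close>, the functional \<open>E\<^sup>iD\<^sup>j \<mapsto> \<alpha>\<^sup>i\<beta>\<^sup>j\<close> gives the total weight of the
  permutations of \<open>{1..n}\<close> with first letter \<open>r\<close>.\<close>

definition slice :: "nat \<Rightarrow> nat \<Rightarrow> 'a" where
  "slice n r = (if n = 1 then 1
     else if r = 1 then y * T ^ (n - 2) * D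
     else if r = n then E * Q ^ (n - 2)
     else y * T ^ (n - 1 - r) * (D + E) * Q ^ (r - 2))"

lemma y_left_commute: "x * (y * z) = y * (x * z)"
  by (metis mult.assoc y_central)

lemma q_left_commute: "x * (q * z) = q * (x * z)"
  by (metis mult.assoc q_central)

lemma exchange_E: "E * Q + y * (D + E) = T * E"
proof -
  have "T * E = y * (D * E) + E * E"
    by (simp add: T_def algebra_simps)
  then show ?thesis
    by (simp add: Q_def relation algebra_simps y_left_commute q_left_commute[of E])
qed

lemma exchange_D: "q * T * D + (D + E) = D * Q"
proof -
  have "D * Q = q * y * (D * D) + D * E"
    by (simp add: Q_def algebra_simps y_left_commute q_left_commute[of D])
  then show ?thesis
    by (simp add: T_def relation algebra_simps y_left_commute)
qed

lemma sum_slice_upper: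
  assumes "2 \<le> r" "r \<le> n"
  shows "(\<Sum>a = r..n. slice n a) = T ^ (n - r) * E * Q ^ (r - 2)"
  using assms(2,1)
proof (induction r rule: inc_induct)
  case base
  then show ?case
    by (simp add: slice_def)
next
  case (step r)
  obtain k where r: "r = k + 2"
    using step.prems by (metis add.commute le_Suc_ex)
  obtain l where n: "n = Suc r + l"
    using step.hyps by (metis Suc_leI le_Suc_ex)
  have "(\<Sum>a = r..n. slice n a) = slice n r + (\<Sum>a = Suc r..n. slice n a)"
    using step.hyps by (simp add: sum.atLeast_Suc_atMost)
  also have "\<dots> = y * T ^ l * (D + E) * Q ^ k + T ^ l * E * Q ^ Suc k"
    using step by (simp add: slice_def r n)
  also have "\<dots> = T ^ l * (E * Q + y * (D + E)) * Q ^ k"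
    by (simp add: algebra_simps y_left_commute)
  also have "\<dots> = T ^ (n - r) * E * Q ^ (r - 2)"
    unfolding exchange_E by (simp add: r n power_Suc2 mult.assoc del: power_Suc)
  finally show ?case .
qed

lemma sum_slice_lower:
  assumes "2 \<le> r" "r \<le> n"
  shows "(\<Sum>a = 1..<r. q ^ (r - 1 - a) * slice n a) = y * T ^ (n - r) * D * Q ^ (r - 2)"
  using assms
proof (induction r rule: dec_induct)
  case base
  then show ?case
    by (simp add: slice_def numeral_2_eq_2)
next
  case (step r)
  obtain k where r: "r = k + 2"
    using step.hyps by (metis add.commute le_Suc_ex)
  obtain l where n: "n = Suc r + l"
    using step.prems by (metis le_Suc_ex)
  have "(\<Sum>a = 1..<Suc r. q ^ (Suc r - 1 - a) * slice n a) =
      (\<Sum>a = 1..<r. q ^ (Suc r - 1 - a) * slice n a) + slice n r"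
    using step.hyps by simp
  also have "(\<Sum>a = 1..<r. q ^ (Suc r - 1 - a) * slice n a) =
      q * (\<Sum>a = 1..<r. q ^ (r - 1 - a) * slice n a)"
    unfolding sum_distrib_left
  proof (rule sum.cong)
    fix a assume "a \<in> {1..<r}"
    then have "Suc r - 1 - a = Suc (r - 1 - a)"
      by auto
    then show "q ^ (Suc r - 1 - a) * slice n a = q * (q ^ (r - 1 - a) * slice n a)"
      by (simp add: mult.assoc)
  qed simp
  also have "\<dots> + slice n r = q * (y * T ^ Suc l * D * Q ^ k) + y * T ^ l * (D + E) * Q ^ k"
    using step by (simp add: slice_def r n)
  also have "\<dots> = y * T ^ l * (q * T * D + (D + E)) * Q ^ k"
    by (simp add: power_Suc2 algebra_simps y_left_commute q_left_commute[of "T ^ l"] del: power_Suc)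
  also have "\<dots> = y * T ^ (n - Suc r) * D * Q ^ (Suc r - 2)"
    unfolding exchange_D by (simp add: r n algebra_simps)
  finally show ?case .
qed

lemma sum_slice:
  assumes "n \<ge> 1"
  shows "(\<Sum>a = 1..n. slice n a) = T ^ (n - 1)"
proof (cases "n = 1")
  case False
  with assms obtain k where n: "n = k + 2"
    by (metis One_nat_def add.commute le_Suc_ex le_neq_implies_less Suc_leI numeral_2_eq_2)
  have "(\<Sum>a = 1..n. slice n a) = slice n 1 + (\<Sum>a = 2..n. slice n a)"
    using assms by (simp add: sum.atLeast_Suc_atMost numeral_2_eq_2)
  also have "(\<Sum>a = 2..n. slice n a) = T ^ k * E"
    by (subst sum_slice_upper) (simp_all add: n)
  also have "slice n 1 = y * T ^ k * D"
    by (simp add: slice_def n)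
  also have "y * T ^ k * D + T ^ k * E = T ^ k * (y * D + E)"
    by (simp add: distrib_left y_left_commute mult.assoc)
  also have "y * D + E = T"
    by (simp add: T_def)
  finally show ?thesis
    by (simp add: n power_commutes)
qed (simp add: slice_def)

lemma sum_q_slice:
  assumes "n \<ge> 1"
  shows "(\<Sum>a = 1..n. q ^ (n - a) * slice n a) = Q ^ (n - 1)"
proof (cases "n = 1")
  case False
  with assms obtain k where n: "n = k + 2"
    by (metis One_nat_def add.commute le_Suc_ex le_neq_implies_less Suc_leI numeral_2_eq_2)
  have "(\<Sum>a = 1..n. q ^ (n - a) * slice n a) =
      (\<Sum>a = 1..<n. q ^ (n - a) * slice n a) + slice n n"
    using assms by (simp add: sum.last_plus add.commute)
  also have "(\<Sum>a = 1..<n. q ^ (n - a) * slice n a) =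
      q * (\<Sum>a = 1..<n. q ^ (n - 1 - a) * slice n a)"
    unfolding sum_distrib_left
  proof (rule sum.cong)
    fix a assume "a \<in> {1..<n}"
    then have "n - a = Suc (n - 1 - a)"
      by auto
    then show "q ^ (n - a) * slice n a = q * (q ^ (n - 1 - a) * slice n a)"
      by (simp add: mult.assoc)
  qed simp
  also have "(\<Sum>a = 1..<n. q ^ (n - 1 - a) * slice n a) = y * D * Q ^ k"
    by (subst sum_slice_lower) (simp_all add: n)
  also have "slice n n = E * Q ^ k"
    by (simp add: slice_def n)
  also have "q * (y * D * Q ^ k) + E * Q ^ k = Q * Q ^ k"
    by (simp add: Q_def distrib_right mult.assoc)
  finally show ?thesis
    by (simp add: n)
qed (simp add: slice_def)

lemma slice_Suc_middle:
  assumes "2 \<le> r" "r \<le> n"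
  shows "slice (n + 1) r =
    y * (\<Sum>a = r..n. slice n a) + (\<Sum>a = 1..<r. q ^ (r - 1 - a) * slice n a)"
proof -
  have "slice (n + 1) r = y * T ^ (n - r) * (D + E) * Q ^ (r - 2)"
    using assms by (simp add: slice_def)
  then show ?thesis
    unfolding sum_slice_upper[OF assms] sum_slice_lower[OF assms] by (simp add: algebra_simps)
qed

lemma slice_Suc_first: "n \<ge> 1 \<Longrightarrow> slice (n + 1) 1 = y * (\<Sum>a = 1..n. slice n a) * D"
  by (subst sum_slice) (simp_all add: slice_def)

lemma slice_Suc_last: "n \<ge> 1 \<Longrightarrow> slice (n + 1) (n + 1) = E * (\<Sum>a = 1..n. q ^ (n - a) * slice n a)"
  by (subst sum_q_slice) (simp_all add: slice_def)

end


section \<open>The partition function\<close>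

interpretation pasep: pasep_relation gen_D gen_E "scalar y_ind" "scalar q_ind"
  by standard (fact gen_D_gen_E scalar_commute)+

lemma pasep_eval_scalar_power_mult:
  "pasep_eval (scalar c ^ k * x) = zyq_embed c ^ k * pasep_eval x"
  by (induction k) (simp_all add: pasep_eval_scalar_mult mult.assoc)

lemma first_weight_eq_pasep_eval:
  assumes "n \<ge> 1" "r \<in> {1..n}"
  shows "first_weight n r = pasep_eval (pasep.slice n r)"
  using assms
proof (induction n arbitrary: r rule: nat_induct_at_least)
  case base
  then have "r = 1"
    by simp
  then show ?case
    by (simp add: first_weight_1 pasep.slice_def del: One_nat_def)
next
  case (Suc n)
  have upper: "(\<Sum>a = r..n. first_weight n a) = pasep_eval (\<Sum>a = r..n. pasep.slice n a)"
    unfolding pasep_eval_sum using Suc by (intro sum.cong) auto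
  have lower: "(\<Sum>a = 1..<r. zyq_embed q_ind ^ (r - 1 - a) * first_weight n a) =
      pasep_eval (\<Sum>a = 1..<r. scalar q_ind ^ (r - 1 - a) * pasep.slice n a)"
    unfolding pasep_eval_sum pasep_eval_scalar_power_mult using Suc by (intro sum.cong) auto
  have rec: "first_weight (n + 1) r =
      alpha_ind ^ of_bool (r = n + 1) * beta_ind ^ of_bool (r = 1) *
      pasep_eval (scalar y_ind * (\<Sum>a = r..n. pasep.slice n a) +
        (\<Sum>a = 1..<r. scalar q_ind ^ (r - 1 - a) * pasep.slice n a))"
    using Suc first_weight_Suc[of n r]
    by (simp only: upper lower pasep_eval_add pasep_eval_scalar_mult Suc_eq_plus1)
  consider "r = 1" | "2 \<le> r" "r \<le> n" | "r = n + 1"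
    using Suc.prems by fastforce
  then have "first_weight (n + 1) r = pasep_eval (pasep.slice (n + 1) r)"
  proof cases
    case 1
    then show ?thesis
      unfolding rec using Suc.hyps by (simp add: pasep.slice_Suc_first[simplified] pasep_eval_mult_D)
  next
    case 2
    then show ?thesis
      unfolding rec pasep.slice_Suc_middle[OF 2] by simp
  next
    case 3
    then show ?thesis
      unfolding rec using Suc.hyps
      by (simp add: pasep.slice_Suc_last[simplified] pasep_eval_E_mult atLeastLessThanSuc_atLeastAtMost)
  qed
  then show ?case
    by simp
qed

theorem theorem3p12:
  fixes N :: nat
  shows "Zbar N =
    (\<Sum>\<sigma> | \<sigma> permutes {1..N + 1}.
       alpha_ind ^ (rl_maxima (N + 1) \<sigma> - 1) *
       beta_ind ^ (rl_minima (N + 1) \<sigma> - 1) *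
       zyq_embed y_ind ^ (asc (N + 1) \<sigma> - 1) *
       zyq_embed q_ind ^ pattern_31_2 (N + 1) \<sigma>)"
proof -
  have "Zbar N = pasep_eval (\<Sum>a = 1..N + 1. pasep.slice (N + 1) a)"
    by (subst pasep.sum_slice) (simp_all add: Zbar_eq_pasep_eval pasep.T_def)
  also have "\<dots> = (\<Sum>a = 1..N + 1. first_weight (N + 1) a)"
    unfolding pasep_eval_sum by (intro sum.cong refl first_weight_eq_pasep_eval[symmetric]) simp_all
  also have "\<dots> = (\<Sum>\<sigma> | \<sigma> permutes {1..N + 1}. perm_weight (N + 1) \<sigma>)"
    using sum_perm_weight[of "N + 1" "\<lambda>_. 1"] by simp
  finally show ?thesis
    unfolding perm_weight_def .
qed

end
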